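(* Let $Y\subseteq\mathbb{R}^p$ be nonempty, $\mathbb{R}^p_{\geqq}$-convex and $\mathbb{R}^p_{\geqq}$-closed. If $(y-\mathbb{R}^p_{\geqq})\cap Y$ is closed for every $y\in Y$, then the following statements are equivalent: (i) $Y_N\neq\emptyset$; (ii) $(y-\mathbb{R}^p_{\geqq})\cap Y$ is bounded for every $y\in Y$; (iii) $Y$ is $\mathbb{R}^p_{\geqq}$-compact; (iv) $Y$ is $\mathbb{R}^p_{\geqq}$-semicompact; (v) $Y_N$ is externally stable.
   Context: For $a,b\in\mathbb{R}^p$: $a\leqq b$ means $a_j\le b_j$ for every $j$; $a\leq b$ means $a\leqq b$ and $a\neq b$. Let $\mathbb{R}^p_{\geqq}=\{y\in\mathbb{R}^p: y_j\ge 0\ \text{for every } j\}$. For $Y\subseteq\mathbb{R}^p$, a point $y^0\in Y$ is nondominated if there is no $y\in Y$ with $y\leq y^0$; $Y_N$ denotes the set of all nondominated points of $Y$. A set $Y\subseteq\mathbb{R}^p$ is called: - $\mathbb{R}^p_{\geqq}$-convex if $Y+\mathbb{R}^p_{\geqq}$ (Minkowski sum) is convex; - $\mathbb{R}^p_{\geqq}$-closed if $Y+\mathbb{R}^p_{\geqq}$ is closed; - $\mathbb{R}^p_{\geqq}$-compact if $(y-\mathbb{R}^p_{\geqq})\cap Y$ is compact for every $y\in Y$; - $\mathbb{R}^p_{\geqq}$-semicompact if every open cover of $Y$ of the form $\{(y^i-\mathbb{R}^p_{\geqq})^c : y^i\in Y,\ i\in\mathcal{I}\}$ has a finite subcover,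 where $S^c$ denotes the complement of $S$ in $\mathbb{R}^p$. The set $Y_N$ is called externally stable if $Y\subseteq Y_N+\mathbb{R}^p_{\geqq}$. *)

theory Defs
  imports "HOL-Analysis.Analysis" "HOL-Library.Set_Algebras"
begin

text \<open>
  The componentwise order on \<open>\<real>\<^sup>p\<close> (the paper's \<open>a \<leqq> b\<close>) is the library order
  \<open>a \<le> b\<close> on \<open>real ^ 'p\<close>; the paper's \<open>a \<le> b\<close> is \<open>a \<le> b \<and> a \<noteq> b\<close>.
  The sum of two sets is the Minkowski sum of \<open>HOL-Library.Set_Algebras\<close>.
\<close>

definition nonneg_orthant :: "(real ^ 'p) set" where
  "nonneg_orthant = {y. \<forall>j. y $ j \<ge> 0}"

definition lower_section :: "real ^ 'p \<Rightarrow> (real ^ 'p) set" where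
  "lower_section y = {y - c | c. c \<in> nonneg_orthant}"

definition nondominated :: "(real ^ 'p) set \<Rightarrow> (real ^ 'p) set" where
  "nondominated Y = {y0 \<in> Y. \<not> (\<exists>y\<in>Y. y \<le> y0 \<and> y \<noteq> y0)}"

definition orthant_convex :: "(real ^ 'p) set \<Rightarrow> bool" where
  "orthant_convex Y \<longleftrightarrow> convex (Y + nonneg_orthant)"

definition orthant_closed :: "(real ^ 'p) set \<Rightarrow> bool" where
  "orthant_closed Y \<longleftrightarrow> closed (Y + nonneg_orthant)"

definition orthant_compact :: "(real ^ 'p) set \<Rightarrow> bool" where
  "orthant_compact Y \<longleftrightarrow> (\<forall>y\<in>Y. compact (lower_section y \<inter> Y))"

text \<open>
  A cover is represented by its set of members, as in \<open>compact_eq_Heine_Borel\<close>; its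
  index set is therefore arbitrary.
\<close>

definition orthant_semicompact :: "(real ^ 'p) set \<Rightarrow> bool" where
  "orthant_semicompact Y \<longleftrightarrow>
     (\<forall>C. C \<subseteq> {- lower_section y | y. y \<in> Y} \<and> (\<forall>U\<in>C. open U) \<and> Y \<subseteq> \<Union>C
        \<longrightarrow> (\<exists>D\<subseteq>C. finite D \<and> Y \<subseteq> \<Union>D))"

text \<open>The property that \<open>Y\<^sub>N\<close> is externally stable, as a predicate of \<open>Y\<close>.\<close>

definition externally_stable :: "(real ^ 'p) set \<Rightarrow> bool" where
  "externally_stable Y \<longleftrightarrow> Y \<subseteq> nondominated Y + nonneg_orthant"

end

theory Submission
  imports Defs
begin

text \<open>
  Everything rests on the closed convex set \<open>Z = Y + \<real>\<^sup>p\<^sub>\<geqq>\<close>.  If some lower section is unbounded,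
  then \<open>Z\<close> has a recession direction \<open>- d\<close> with \<open>d \<ge> 0\<close>, \<open>d \<noteq> 0\<close>, so every point of \<open>Y\<close> is
  dominated by a point of \<open>Y\<close> below its translate by \<open>- d\<close>.  Hence there is no nondominated point,
  and iterating gives a decreasing sequence in \<open>Y\<close> without a lower bound, whose lower sections
  have complements forming a cover without finite subcover.  Conversely, if lower sections are
  compact, the part of \<open>Y\<close> missed by one member of a cover is compact, which gives a finite
  subcover, and minimizing the coordinate sum over a lower section yields a nondominated point.
\<close>

lemma nonneg_orthant_eq: "nonneg_orthant = {0 :: real ^ 'p..}"
  by (auto simp: nonneg_orthant_def less_eq_vec_def)

lemma lower_section_eq: "lower_section y = {..y}" for y :: "real ^ 'p"
proof (intro set_eqI iffI)
  fix z assume "z \<in> {..y}"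
  then have "z = y - (y - z)" "y - z \<in> nonneg_orthant"
    by (auto simp: nonneg_orthant_eq)
  then show "z \<in> lower_section y"
    unfolding lower_section_def by blast
qed (auto simp: lower_section_def nonneg_orthant_def less_eq_vec_def)

lemma mem_plus_nonneg_orthant_iff:
  "z \<in> Y + nonneg_orthant \<longleftrightarrow> (\<exists>y\<in>Y. y \<le> z)" for z :: "real ^ 'p"
proof
  assume "\<exists>y\<in>Y. y \<le> z"
  then obtain y where "y \<in> Y" "y \<le> z" by blast
  then show "z \<in> Y + nonneg_orthant"
    using set_plus_intro[of y Y "z - y" nonneg_orthant] by (simp add: nonneg_orthant_eq)
qed (force simp: nonneg_orthant_def less_eq_vec_def elim!: set_plus_elim)

text \<open>Normalizing ever longer vectors \<open>k\<close> and using compactness of the unit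
  sphere gives a limit direction \<open>d\<close> in the closed cone \<open>K\<close>. Moving from
  \<open>z\<close> towards \<open>a - k\<close> by the fraction \<open>1 / norm k\<close> stays in
  the convex set \<open>Z\<close> and tends to \<open>z - d\<close>, which closedness keeps in
  \<open>Z\<close>.\<close>

lemma unbounded_recession_direction:
  fixes Z K :: "'a::euclidean_space set"
  assumes "closed Z" "convex Z" "closed K" "cone K"
    and unb: "\<not> bounded {k \<in> K. a - k \<in> Z}"
  shows "\<exists>d\<in>K. d \<noteq> 0 \<and> (\<forall>z\<in>Z. z - d \<in> Z)"
proof -
  \<comment> \<open>The bound \<open>real n + 1\<close> makes \<open>1 / norm (k n)\<close> tend to
    0 and also keeps it below 1 from \<open>n = 0\<close> on, so that it can serve as a convex
    weight.\<close>
  have "\<exists>k\<in>K. a - k \<in> Z \<and> real n + 1 < norm k" for n :: nat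
    using unb unfolding bounded_iff by (auto simp: not_le)
  then obtain k where k: "\<And>n. k n \<in> K" "\<And>n. a - k n \<in> Z" "\<And>n. real n + 1 < norm (k n)"
    by metis
  define u where "u n = (1 / norm (k n)) *\<^sub>R k n" for n
  have pos: "0 < norm (k n)" for n
    using k(3)[of n] by linarith
  have "u n \<in> sphere 0 1" for n
    using pos[of n] by (simp add: u_def)
  with compact_sphere[of "0::'a" 1] obtain d r where
    d: "d \<in> sphere 0 1" "strict_mono r" "(u \<circ> r) \<longlonglongrightarrow> d"
    unfolding compact_def by metis
  have inv0: "(\<lambda>n. 1 / norm (k n)) \<longlonglongrightarrow> 0"
  proof (rule tendsto_sandwich[OF _ _ tendsto_const LIMSEQ_inverse_real_of_nat])
    have "1 / norm (k n) \<le> inverse (real (Suc n))" for n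
      unfolding inverse_eq_divide using k(3)[of n] pos[of n] by (intro frac_le) auto
    then show "\<forall>\<^sub>F n in sequentially. 1 / norm (k n) \<le> inverse (real (Suc n))"
      by simp
  qed simp
  then have t0: "(\<lambda>n. 1 / norm (k (r n))) \<longlonglongrightarrow> 0"
    using LIMSEQ_subseq_LIMSEQ[OF _ d(2)] by (force simp: o_def)
  have "(u \<circ> r) n \<in> K" for n
    using k(1) \<open>cone K\<close> by (simp add: u_def cone_def)
  then have "d \<in> K"
    using closed_sequentially[OF \<open>closed K\<close> _ d(3)] by blast
  moreover have "z - d \<in> Z" if "z \<in> Z" for z
  proof -
    define t where "t n = 1 / norm (k (r n))" for n
    \<comment> \<open>This form isolates the vanishing term \<open>t n *\<^sub>R (a - z)\<close>
      from the convergent directions, so the limit \<open>z - d\<close> can be read off.\<close>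
    have eq: "(1 - t n) *\<^sub>R z + t n *\<^sub>R (a - k (r n)) = z + t n *\<^sub>R (a - z) - (u \<circ> r) n" for n
      by (simp add: t_def u_def algebra_simps)
    have "(1 - t n) *\<^sub>R z + t n *\<^sub>R (a - k (r n)) \<in> Z" for n
    proof (rule convexD_alt[OF \<open>convex Z\<close> that k(2)])
      show "0 \<le> t n" "t n \<le> 1"
        using k(3)[of "r n"] pos[of "r n"] by (auto simp: t_def)
    qed
    then have mem: "z + t n *\<^sub>R (a - z) - (u \<circ> r) n \<in> Z" for n
      by (simp only: eq)
    have "(\<lambda>n. z + t n *\<^sub>R (a - z) - (u \<circ> r) n) \<longlonglongrightarrow> z + 0 *\<^sub>R (a - z) - d"
      using t0 d(3) unfolding t_def by (intro tendsto_intros)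
    with mem show ?thesis
      using closed_sequentially[OF \<open>closed Z\<close>] by fastforce
  qed
  ultimately show ?thesis
    using d(1) by (intro bexI[of _ d]) auto
qed

text \<open>The recession direction belongs to the sum \<open>Y + nonneg_orthant\<close>, not to
  \<open>Y\<close> itself. Hence \<open>y - d\<close> need not lie in \<open>Y\<close>, but some
  point of \<open>Y\<close> lies below it.\<close>

lemma unbounded_section_descent:
  fixes Y :: "(real ^ 'p) set"
  assumes "orthant_convex Y" "orthant_closed Y" "\<not> bounded (lower_section a \<inter> Y)"
  obtains d where "d \<ge> 0" "d \<noteq> 0" "\<forall>y\<in>Y. \<exists>y'\<in>Y. y' \<le> y - d"
proof -
  let ?Z = "Y + nonneg_orthant"
  \<comment> \<open>The reflection \<open>k \<mapsto> a - k\<close> preserves boundedness, and its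
    image of \<open>?B\<close> contains the lower section of \<open>a\<close> in
    \<open>Y\<close>.\<close>
  have "\<not> bounded {k \<in> nonneg_orthant. a - k \<in> ?Z}" (is "\<not> bounded ?B")
  proof
    assume "bounded ?B"
    then have "bounded ((\<lambda>k. a - k) ` ?B)"
      using bounded_translation[OF bounded_uminus[THEN iffD2], of ?B a] by (simp add: image_image)
    moreover have "lower_section a \<inter> Y \<subseteq> (\<lambda>k. a - k) ` ?B"
      unfolding lower_section_def by (force simp: mem_plus_nonneg_orthant_iff)
    ultimately show False
      using assms(3) bounded_subset by blast
  qed
  moreover have "closed (nonneg_orthant :: (real ^ 'p) set)"
    by (simp add: nonneg_orthant_eq)
  moreover have "cone (nonneg_orthant :: (real ^ 'p) set)"
    by (simp add: cone_def nonneg_orthant_def)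
  ultimately obtain d where d: "d \<in> nonneg_orthant" "d \<noteq> 0" "\<forall>z\<in>?Z. z - d \<in> ?Z"
    using unbounded_recession_direction[of ?Z nonneg_orthant a] assms(1,2)
    unfolding orthant_convex_def orthant_closed_def by blast
  show thesis
  proof (rule that)
    show "\<forall>y\<in>Y. \<exists>y'\<in>Y. y' \<le> y - d"
      using d(3) by (meson mem_plus_nonneg_orthant_iff order_refl)
  qed (use d(1,2) in \<open>auto simp: nonneg_orthant_eq\<close>)
qed

lemma nondominated_imp_bounded_section:
  fixes Y :: "(real ^ 'p) set"
  assumes "orthant_convex Y" "orthant_closed Y" "nondominated Y \<noteq> {}"
  shows "bounded (lower_section a \<inter> Y)"
proof (rule ccontr)
  assume unb: "\<not> bounded (lower_section a \<inter> Y)"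
  obtain d where d: "d \<ge> 0" "d \<noteq> 0" "\<forall>y\<in>Y. \<exists>y'\<in>Y. y' \<le> y - d"
    by (rule unbounded_section_descent[OF assms(1,2) unb])
  obtain y0 where y0: "y0 \<in> Y" "\<And>y. y \<in> Y \<Longrightarrow> y \<le> y0 \<Longrightarrow> y = y0"
    using assms(3) unfolding nondominated_def by blast
  obtain y where y: "y \<in> Y" "y \<le> y0 - d"
    using d(3) y0(1) by blast
  moreover have "y0 - d \<le> y0"
    using d(1) by simp
  ultimately have "y = y0"
    using y0(2) order_trans by blast
  with y(2) d(1,2) show False
    by (simp add: le_diff_eq)
qed

text \<open>Repeated descent by \<open>d\<close> yields a decreasing sequence without a lower bound.
  The complements of its lower sections cover \<open>Y\<close>, but any finitely many of them miss a
  late enough term of the sequence.\<close>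

lemma semicompact_imp_bounded_section:
  fixes Y :: "(real ^ 'p) set"
  assumes "orthant_convex Y" "orthant_closed Y" "orthant_semicompact Y" "Y \<noteq> {}"
  shows "bounded (lower_section a \<inter> Y)"
proof (rule ccontr)
  assume unb: "\<not> bounded (lower_section a \<inter> Y)"
  obtain d where d: "d \<ge> 0" "d \<noteq> 0" "\<forall>y\<in>Y. \<exists>y'\<in>Y. y' \<le> y - d"
    by (rule unbounded_section_descent[OF assms(1,2) unb])
  have "\<exists>y. \<forall>n::nat. y n \<in> Y \<and> y (Suc n) \<le> y n - d"
    using d(3) assms(4) by (intro dependent_nat_choice) auto
  then obtain y :: "nat \<Rightarrow> real ^ 'p"
    where y: "\<And>n. y n \<in> Y" "\<And>n. y (Suc n) \<le> y n - d"
    by blast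
  have y_bound: "y n \<le> y 0 - real n *\<^sub>R d" for n
  proof (induction n)
    case (Suc n)
    have "y (Suc n) \<le> y n - d" by (rule y(2))
    also have "\<dots> \<le> y 0 - real n *\<^sub>R d - d"
      using Suc by (rule diff_right_mono)
    finally show ?case by (simp add: algebra_simps)
  qed simp
  have "y (Suc n) \<le> y n" for n
    using order_trans[OF y(2)[of n], of "y n"] d(1) by simp
  then have decr: "y n \<le> y m" if "m \<le> n" for m n
    using lift_Suc_antimono_le[of y, OF _ that] by blast
  define C where "C = (\<lambda>n. - lower_section (y n)) ` UNIV"
  \<comment> \<open>In a coordinate where \<open>d\<close> is positive, the bound
    \<open>y 0 - real n *\<^sub>R d\<close> eventually falls below \<open>z\<close>.\<close>
  have "\<exists>n. \<not> z \<le> y n" for z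
  proof (rule ccontr)
    assume "\<nexists>n. \<not> z \<le> y n"
    then have le: "z \<le> y 0 - real n *\<^sub>R d" for n
      using y_bound order_trans by blast
    obtain j where j: "0 < d $ j"
      using d(1,2) by (auto simp: less_eq_vec_def vec_eq_iff less_le)
    obtain n where "y 0 $ j - z $ j < real n * d $ j"
      using reals_Archimedean3[OF j] by blast
    with le[of n] show False
      by (auto simp: less_eq_vec_def dest!: spec[of _ j])
  qed
  then have "Y \<subseteq> \<Union>C"
    by (auto simp: C_def lower_section_eq)
  moreover have "C \<subseteq> {- lower_section y | y. y \<in> Y}"
    using y(1) by (auto simp: C_def)
  moreover have "\<forall>U\<in>C. open U"
    by (auto simp: C_def lower_section_eq)
  ultimately have "\<exists>D\<subseteq>C. finite D \<and> Y \<subseteq> \<Union>D"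
    using assms(3)[unfolded orthant_semicompact_def, rule_format, of C] by blast
  then obtain D where D: "D \<subseteq> C" "finite D" "Y \<subseteq> \<Union>D"
    by blast
  obtain F where F: "finite F" "D = (\<lambda>n. - lower_section (y n)) ` F"
    using finite_subset_image[OF D(2) D(1)[unfolded C_def]] by auto
  obtain N where N: "\<And>n. n \<in> F \<Longrightarrow> n \<le> N"
    using F(1) by (meson finite_nat_set_iff_bounded_le)
  \<comment> \<open>As \<open>N\<close> bounds all indices in \<open>F\<close>, the point
    \<open>y N\<close> lies in the lower section of each \<open>y n\<close> with \<open>n\<close> in
    \<open>F\<close>, hence in no member of \<open>D\<close>.\<close>
  have "y N \<in> \<Union>D"
    using D(3) y(1) by blast
  then show False
    using F(2) N decr by (auto simp: lower_section_eq)
qed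

lemma orthant_compact_imp_semicompact:
  assumes "orthant_compact Y"
  shows "orthant_semicompact Y"
  unfolding orthant_semicompact_def
proof (intro allI impI, elim conjE)
  fix C assume C: "C \<subseteq> {- lower_section y | y. y \<in> Y}" "\<forall>U\<in>C. open U" "Y \<subseteq> \<Union>C"
  show "\<exists>D\<subseteq>C. finite D \<and> Y \<subseteq> \<Union>D"
  \<comment> \<open>A nonempty cover has a member to split off, and what it misses of
    \<open>Y\<close> is a compact section. An empty cover forces \<open>Y\<close> to be
    empty.\<close>
  proof (cases "C = {}")
    case False
    then obtain y where y: "y \<in> Y" "- lower_section y \<in> C"
      using C(1) by blast
    with assms have "compact (lower_section y \<inter> Y)"
      by (simp add: orthant_compact_def)
    then obtain D where D: "D \<subseteq> C" "finite D" "lower_section y \<inter> Y \<subseteq> \<Union>D"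
      using C(2,3) by (meson compactE inf.coboundedI2)
    have "Y \<subseteq> \<Union>(insert (- lower_section y) D)"
      using D(3) by auto
    with D y(2) show ?thesis
      by (metis finite_insert insert_subset)
  qed (use C(3) in auto)
qed

text \<open>The coordinate sum is strictly monotone and attains its minimum on the compact section
  below \<open>y\<close>. A point of \<open>Y\<close> dominating the minimizer would lie in the same
  section and have a smaller sum.\<close>

lemma orthant_compact_imp_externally_stable:
  fixes Y :: "(real ^ 'p) set"
  assumes "orthant_compact Y"
  shows "externally_stable Y"
  unfolding externally_stable_def
proof
  fix y assume "y \<in> Y"
  then have "compact (lower_section y \<inter> Y)" "lower_section y \<inter> Y \<noteq> {}"
    using assms by (auto simp: orthant_compact_def lower_section_eq)
  moreover have "continuous_on (lower_section y \<inter> Y) (\<lambda>z. \<Sum>j\<in>UNIV. z $ j)"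
    by (intro continuous_intros)
  ultimately obtain m where m: "m \<in> lower_section y \<inter> Y"
    and min: "\<forall>z\<in>lower_section y \<inter> Y. (\<Sum>j\<in>UNIV. m $ j) \<le> (\<Sum>j\<in>UNIV. z $ j)"
    by (metis continuous_attains_inf)
  have "z = m" if z: "z \<in> Y" "z \<le> m" for z
  proof (rule ccontr)
    assume "z \<noteq> m"
    then have "(\<Sum>j\<in>UNIV. z $ j) < (\<Sum>j\<in>UNIV. m $ j)"
      using z(2) by (intro sum_strict_mono_ex1) (auto simp: less_eq_vec_def vec_eq_iff less_le)
    moreover have "z \<in> lower_section y \<inter> Y"
      using z m by (auto simp: lower_section_eq)
    then have "(\<Sum>j\<in>UNIV. m $ j) \<le> (\<Sum>j\<in>UNIV. z $ j)"
      by (rule min[rule_format])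
    ultimately show False
      by simp
  qed
  with m have "m \<in> nondominated Y"
    by (auto simp: nondominated_def)
  with m show "y \<in> nondominated Y + nonneg_orthant"
    by (auto simp: mem_plus_nonneg_orthant_iff lower_section_eq)
qed

theorem theorem4p2:
  fixes Y :: "(real ^ 'p) set"
  assumes "Y \<noteq> {}"
    and "orthant_convex Y"
    and "orthant_closed Y"
    and "\<forall>y\<in>Y. closed (lower_section y \<inter> Y)"
  shows "(nondominated Y \<noteq> {} \<longleftrightarrow> (\<forall>y\<in>Y. bounded (lower_section y \<inter> Y))) \<and>
    ((\<forall>y\<in>Y. bounded (lower_section y \<inter> Y)) \<longleftrightarrow> orthant_compact Y) \<and>
    (orthant_compact Y \<longleftrightarrow> orthant_semicompact Y) \<and>
    (orthant_semicompact Y \<longleftrightarrow> externally_stable Y)"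
proof -
  \<comment> \<open>By Heine-Borel, the closedness assumed of the sections reduces their compactness
    to boundedness.\<close>
  have "(\<forall>y\<in>Y. bounded (lower_section y \<inter> Y)) \<longleftrightarrow> orthant_compact Y"
    using assms(4) by (auto simp: orthant_compact_def compact_eq_bounded_closed)
  moreover have "externally_stable Y \<Longrightarrow> nondominated Y \<noteq> {}"
    using assms(1) by (auto simp: externally_stable_def mem_plus_nonneg_orthant_iff)
  \<comment> \<open>Two cycles close the equivalences: compact, semicompact, bounded, compact; and
    compact, externally stable, some nondominated point, bounded, compact.\<close>
  ultimately show ?thesis
    using nondominated_imp_bounded_section[OF assms(2,3)]
      semicompact_imp_bounded_section[OF assms(2,3) _ assms(1)]
      orthant_compact_imp_semicompact orthant_compact_imp_externally_stable
    by blast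
qed

end
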